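(* Let $A$ be a polarized complex Abelian variety of dimension $3$. For an integer $t\ge 1$ let $N_A(t)$ be the number of elliptic curves in $A$ of degree $\le t$ with respect to the polarization. Then $N_A(t)$ has an upper bound which is asymptotically of order $O(t^5)$; that is, $N_A(t)=O(t^5)$ as $t\to\infty$ (with implied constant depending on $A$ and its polarization).
   Context: "Elliptic curve in" a complex torus $A$ means a one-dimensional complex subtorus of $A$ (so it passes through the origin). The degree of an elliptic curve $F\subset A$ with respect to a polarization with associated divisor $\Theta$ is the intersection number $F\cdot\Theta$. *)

theory Defs
  imports "HOL-Complex_Analysis.Complex_Analysis" "HOL-Library.Landau_Symbols"
begin

section \<open>Complex tori and their subtori\<close>

text \<open>
  The unqualified \<^const>\<open>span\<close> is the real span; \<open>vec.subspace\<close>, \<open>vec.dim\<close>, \<open>vec.span\<close>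
  refer to the complex vector space structure on \<open>complex ^ 'n\<close>.
\<close>

definition lattice_in :: "(complex ^ 'n) set \<Rightarrow> (complex ^ 'n) set \<Rightarrow> bool" where
  "lattice_in \<Gamma> W \<longleftrightarrow>
     0 \<in> \<Gamma> \<and> (\<forall>x\<in>\<Gamma>. \<forall>y\<in>\<Gamma>. x - y \<in> \<Gamma>) \<and> discrete \<Gamma> \<and> span \<Gamma> = W"

text \<open>The points of the complex torus \<open>\<complex>\<^sup>n / \<Lambda>\<close> are the cosets of \<open>\<Lambda>\<close>.\<close>

definition torus_proj :: "(complex ^ 'n) set \<Rightarrow> complex ^ 'n \<Rightarrow> (complex ^ 'n) set" where
  "torus_proj \<Lambda> z = (\<lambda>l. z + l) ` \<Lambda>"

definition complex_subtorus ::
  "(complex ^ 'n) set \<Rightarrow> nat \<Rightarrow> (complex ^ 'n) set set \<Rightarrow> bool" where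
  "complex_subtorus \<Lambda> d S \<longleftrightarrow>
     (\<exists>W. vec.subspace W \<and> vec.dim W = d \<and> lattice_in (\<Lambda> \<inter> W) W \<and> S = torus_proj \<Lambda> ` W)"

definition elliptic_curve_in :: "(complex ^ 'n) set \<Rightarrow> (complex ^ 'n) set set \<Rightarrow> bool" where
  "elliptic_curve_in \<Lambda> F \<longleftrightarrow> complex_subtorus \<Lambda> 1 F"


section \<open>Polarizations and divisors\<close>

definition hermitian_form :: "(complex ^ 'n \<Rightarrow> complex ^ 'n \<Rightarrow> complex) \<Rightarrow> bool" where
  "hermitian_form H \<longleftrightarrow>
     (\<forall>u v w. H (u + v) w = H u w + H v w) \<and>
     (\<forall>c u v. H (c *s u) v = c * H u v) \<and>
     (\<forall>u v. H v u = cnj (H u v))"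

definition polarization ::
  "(complex ^ 'n) set \<Rightarrow> (complex ^ 'n \<Rightarrow> complex ^ 'n \<Rightarrow> complex) \<Rightarrow> bool" where
  "polarization \<Lambda> H \<longleftrightarrow>
     hermitian_form H \<and> (\<forall>v. v \<noteq> 0 \<longrightarrow> Re (H v v) > 0) \<and>
     (\<forall>l\<in>\<Lambda>. \<forall>m\<in>\<Lambda>. Im (H l m) \<in> \<int>)"

definition entire :: "(complex ^ 'n \<Rightarrow> complex) \<Rightarrow> bool" where
  "entire f \<longleftrightarrow>
     (\<forall>z. \<exists>D. (f has_derivative D) (at z) \<and> (\<forall>c v. D (c *s v) = c * D v))"

text \<open>
  Every effective divisor on \<open>\<complex>\<^sup>n / \<Lambda>\<close> pulls back to the zero divisor of an entire function \<open>\<theta>\<close>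
  on \<open>\<complex>\<^sup>n\<close> with \<open>\<theta>(z + l) = exp(2\<pi>i g\<^sub>l(z)) \<theta>(z)\<close>, and each such \<open>\<theta> \<noteq> 0\<close> defines an effective
  divisor \<open>\<Theta>\<close>; we work with \<open>\<theta>\<close> in place of \<open>\<Theta>\<close>.  The first Chern class of \<open>O(\<Theta>)\<close> is the
  alternating form \<open>g\<^sub>m(z + l) + g\<^sub>l(z) - g\<^sub>l(z + m) - g\<^sub>m(z)\<close> on \<open>\<Lambda>\<close>, equivalently the Hermitian form
  whose imaginary part it is.  So \<open>associated_divisor \<Lambda> H \<theta>\<close> says that the class of \<open>\<Theta>\<close> is \<open>H\<close>.
\<close>

definition associated_divisor ::
  "(complex ^ 'n) set \<Rightarrow> (complex ^ 'n \<Rightarrow> complex ^ 'n \<Rightarrow> complex) \<Rightarrow>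
   (complex ^ 'n \<Rightarrow> complex) \<Rightarrow> bool" where
  "associated_divisor \<Lambda> H \<theta> \<longleftrightarrow>
     entire \<theta> \<and> (\<exists>z. \<theta> z \<noteq> 0) \<and>
     (\<exists>g. (\<forall>l\<in>\<Lambda>. entire (g l)) \<and>
          (\<forall>l\<in>\<Lambda>. \<forall>z. \<theta> (z + l) = exp (2 * of_real pi * \<i> * g l z) * \<theta> z) \<and>
          (\<forall>l\<in>\<Lambda>. \<forall>m\<in>\<Lambda>. \<forall>z.
             of_real (Im (H l m)) = g m (z + l) + g l z - g l (z + m) - g m z))"


section \<open>Intersection numbers and the degree\<close>

definition divisor_support ::
  "(complex ^ 'n) set \<Rightarrow> (complex ^ 'n \<Rightarrow> complex) \<Rightarrow> (complex ^ 'n) set set" where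
  "divisor_support \<Lambda> \<theta> = torus_proj \<Lambda> ` {z. \<theta> z = 0}"

definition translate :: "complex ^ 'n \<Rightarrow> (complex ^ 'n) set set \<Rightarrow> (complex ^ 'n) set set" where
  "translate a F = (\<lambda>p. (\<lambda>z. a + z) ` p) ` F"

text \<open>
  Local intersection multiplicity at the point \<open>p\<close> of \<open>\<Theta>\<close> with the curve through \<open>p\<close> in direction
  \<open>w\<close>.  Replacing the representative \<open>z\<close> of \<open>p\<close> only changes the function by a unit.
\<close>

definition local_intersection ::
  "(complex ^ 'n \<Rightarrow> complex) \<Rightarrow> complex ^ 'n \<Rightarrow> (complex ^ 'n) set \<Rightarrow> int" where
  "local_intersection \<theta> w p = zorder (\<lambda>u. \<theta> ((SOME z. z \<in> p) + u *s w)) 0"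

text \<open>
  \<open>F \<cdot> \<Theta>\<close> for an elliptic curve \<open>F\<close>: the number of intersection points, with multiplicity, of \<open>\<Theta>\<close>
  with any translate of \<open>F\<close> not contained in \<open>\<Theta>\<close>.  If \<open>F\<close> itself is not contained in \<open>\<Theta>\<close> one can
  take \<open>a = 0\<close>; otherwise \<open>F\<close> has to be moved in its algebraic equivalence class.
  The vector \<open>w\<close> is a tangent vector of \<open>F\<close>.
\<close>

definition intersection_number ::
  "(complex ^ 'n) set \<Rightarrow> (complex ^ 'n) set set \<Rightarrow> (complex ^ 'n \<Rightarrow> complex) \<Rightarrow> int" where
  "intersection_number \<Lambda> F \<theta> =
     (THE n. \<forall>a w. w \<noteq> 0 \<longrightarrow> torus_proj \<Lambda> ` vec.span {w} = F \<longrightarrow>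
                \<not> translate a F \<subseteq> divisor_support \<Lambda> \<theta> \<longrightarrow>
                n = (\<Sum>p \<in> translate a F \<inter> divisor_support \<Lambda> \<theta>. local_intersection \<theta> w p))"

definition elliptic_curves_upto ::
  "(complex ^ 'n) set \<Rightarrow> (complex ^ 'n \<Rightarrow> complex) \<Rightarrow> nat \<Rightarrow> (complex ^ 'n) set set set" where
  "elliptic_curves_upto \<Lambda> \<theta> t =
     {F. elliptic_curve_in \<Lambda> F \<and> intersection_number \<Lambda> F \<theta> \<le> int t}"

end

theory Submission
  imports Defs
begin

text \<open>
  Write an elliptic curve as \<open>\<complex>w\<close> modulo \<open>L = {u. u w \<in> \<Lambda>}\<close>.  Restricting \<open>\<theta>\<close> to a translate of the
  line and integrating the logarithmic derivative around a fundamental cell of \<open>L\<close>, the contributions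
  of opposite sides differ only by the factors of automorphy, so the degree is
  \<open>- Im H(l w, m w) = Im(l\<^sup>* m) H(w, w)\<close> for an oriented basis \<open>l, m\<close> of \<open>L\<close>: it is the area of the
  cell in the metric \<open>Re H\<close>.  A shortest nonzero vector of a plane lattice has squared length at most
  twice the area, so a curve of degree at most \<open>t\<close> is spanned by some \<open>x \<in> \<Lambda>\<close> with \<open>H(x, x) \<le> 2t\<close>.
  By a volume estimate the rank 6 lattice \<open>\<Lambda>\<close> has \<open>O(t\<^sup>3)\<close> such vectors, which is even better than
  \<open>O(t\<^sup>5)\<close>.
\<close>

subsection \<open>Discrete subgroups\<close>

text \<open>Packing argument: balls of radius \<open>r\<close> around the points of \<Gamma> are
  disjoint, and those centred in \<open>cball 0 R\<close> lie in \<open>ball 0 (R + r)\<close>.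
  Comparing volumes bounds their number.\<close>

lemma discrete_subgroup_card_bound:
  fixes \<Gamma> :: "'a::euclidean_space set"
  assumes "0 \<in> \<Gamma>" and diff: "\<And>x y. x \<in> \<Gamma> \<Longrightarrow> y \<in> \<Gamma> \<Longrightarrow> x - y \<in> \<Gamma>" and "discrete \<Gamma>"
  obtains C :: real where "C > 0"
    "\<And>R. R \<ge> 1 \<Longrightarrow> finite (\<Gamma> \<inter> cball 0 R)"
    "\<And>R. R \<ge> 1 \<Longrightarrow> real (card (\<Gamma> \<inter> cball 0 R)) \<le> C * R ^ DIM('a)"
proof -
  \<comment> \<open>Closure under differences turns the isolation radius \<open>d\<close> of 0 into
    a lower bound for the distance of any two distinct points.\<close>
  obtain d where d: "d > 0" "\<And>y. y \<in> \<Gamma> \<Longrightarrow> dist 0 y < d \<Longrightarrow> y = 0"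
    using discreteD[OF \<open>discrete \<Gamma>\<close> \<open>0 \<in> \<Gamma>\<close>] by (auto elim!: isolated_inE_dist)
  define r where "r = d / 2"
  have r: "r > 0" using d by (simp add: r_def)
  have disj: "ball x r \<inter> ball y r = {}" if "x \<in> \<Gamma>" "y \<in> \<Gamma>" "x \<noteq> y" for x y
  proof -
    have "\<not> dist 0 (x - y) < d"
      using d(2)[OF diff[OF that(1,2)]] that(3) by auto
    then have "2 * r \<le> dist x y"
      by (simp add: r_def dist_norm norm_minus_commute)
    then show ?thesis
      by (smt (verit) disjoint_iff dist_commute dist_triangle mem_ball)
  qed
  have fm: "ball x s \<in> fmeasurable lborel" for x :: 'a and s
    using emeasure_bounded_finite[OF bounded_ball, of x s] by (intro fmeasurableI) (auto simp: less_top)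
  have card_le: "real (card G) \<le> ((1 + r) / r) ^ DIM('a) * R ^ DIM('a)"
    if G: "G \<subseteq> \<Gamma> \<inter> cball 0 R" "finite G" and R: "R \<ge> 1" for G and R :: real
  proof -
    define v where "v = measure lborel (ball (0 :: 'a) 1)"
    have v: "v > 0" by (simp add: v_def content_ball_pos)
    have "real (card G) * (r ^ DIM('a) * v) = (\<Sum>x\<in>G. measure lborel (ball x r))"
      using r by (simp add: v_def content_ball_conv_unit_ball[of r])
    also have "\<dots> = measure lborel (\<Union>x\<in>G. ball x r)"
      using G disj by (intro measure_UNION' [symmetric]) (auto simp: pairwise_def disjnt_def fm)
    also have "\<dots> \<le> measure lborel (ball (0 :: 'a) (R + r))"
    proof (rule measure_mono_fmeasurable)
      show "(\<Union>x\<in>G. ball x r) \<subseteq> ball 0 (R + r)"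
      proof
        fix y assume "y \<in> (\<Union>x\<in>G. ball x r)"
        then obtain x where "x \<in> G" "dist x y < r" by auto
        moreover from this have "norm x \<le> R" using G by auto
        ultimately show "y \<in> ball 0 (R + r)"
          using norm_triangle_ineq2[of y x] by (simp add: dist_norm norm_minus_commute)
      qed
    qed (use G in \<open>auto simp: fm\<close>)
    also have "\<dots> = (R + r) ^ DIM('a) * v"
      using r R by (simp add: v_def content_ball_conv_unit_ball[of "R + r"])
    finally have "real (card G) * r ^ DIM('a) \<le> (R + r) ^ DIM('a)"
      using v by (simp add: mult.assoc [symmetric])
    \<comment> \<open>Here \<open>R \<ge> 1\<close> absorbs the additive \<open>r\<close> into a
      factor, leaving a pure power of \<open>R\<close>.\<close>
    also have "\<dots> \<le> ((1 + r) * R) ^ DIM('a)"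
    proof (intro power_mono)
      show "R + r \<le> (1 + r) * R" using mult_left_mono[OF R, of r] r by (simp add: algebra_simps)
    qed (use r R in auto)
    finally show ?thesis
      using r by (simp add: power_mult_distrib power_divide divide_simps)
  qed
  show thesis
  proof (rule that)
    show "((1 + r) / r) ^ DIM('a) > 0" using r by simp
    fix R :: real assume R: "R \<ge> 1"
    \<comment> \<open>Every finite subset obeys the packing bound, so the whole set is finite and
      obeys it too.\<close>
    have *: "finite (\<Gamma> \<inter> cball 0 R) \<and>
        card (\<Gamma> \<inter> cball 0 R) \<le> nat \<lfloor>((1 + r) / r) ^ DIM('a) * R ^ DIM('a)\<rfloor>"
      by (rule finite_if_finite_subsets_card_bdd) (use card_le R in \<open>simp add: le_nat_floor\<close>)
    then show "finite (\<Gamma> \<inter> cball 0 R)" ..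
    with card_le[OF order.refl _ R]
    show "real (card (\<Gamma> \<inter> cball 0 R)) \<le> ((1 + r) / r) ^ DIM('a) * R ^ DIM('a)"
      by simp
  qed
qed

lemma countable_if_finite_cballs:
  fixes S :: "'a::real_normed_vector set"
  assumes "\<And>R. R \<ge> 1 \<Longrightarrow> finite (S \<inter> cball 0 R)"
  shows "countable S"
proof -
  have "S = (\<Union>n::nat. S \<inter> cball 0 (1 + real n))"
  proof safe
    fix x assume "x \<in> S"
    obtain n :: nat where "norm x \<le> real n" using real_arch_simple by blast
    then show "x \<in> (\<Union>n::nat. S \<inter> cball 0 (1 + real n))"
      using \<open>x \<in> S\<close> by (auto intro!: exI[of _ n])
  qed
  moreover have "countable (\<Union>n::nat. S \<inter> cball 0 (1 + real n))"
    by (intro countable_UN countableI_type countable_finite assms) simp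
  ultimately show ?thesis by simp
qed

text \<open>Any element \<open>s\<close> cuts the search down to the finite set of elements of norm
  at most \<open>norm s\<close>; whatever lies outside is longer.\<close>

lemma ex_norm_minimal:
  fixes S :: "'a::real_normed_vector set"
  assumes "\<And>R. finite (S \<inter> cball 0 R)" and "S \<noteq> {}"
  obtains x where "x \<in> S" "\<And>y. y \<in> S \<Longrightarrow> norm x \<le> norm y"
proof -
  obtain s where "s \<in> S" using assms by auto
  let ?T = "S \<inter> cball 0 (norm s)"
  have "finite (norm ` ?T)" "norm ` ?T \<noteq> {}" using assms(1) \<open>s \<in> S\<close> by auto
  then have "Min (norm ` ?T) \<in> norm ` ?T" by (rule Min_in)
  then obtain x where x: "x \<in> ?T" "norm x = Min (norm ` ?T)" by auto
  have "norm x \<le> norm y" if "y \<in> S" for y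
  proof (cases "y \<in> ?T")
    case True
    then show ?thesis using x(2) assms(1) by simp
  next
    case False
    then show ?thesis using x(1) that by auto
  qed
  with x show thesis using that by blast
qed

subsection \<open>Plane lattices\<close>

text \<open>Lagrange's identity: the real part of \<open>cnj z * w\<close> is the Euclidean inner
  product of \<open>z\<close> and \<open>w\<close>, the imaginary part the signed area of their
  parallelogram.\<close>

lemma cmod_prod_sq_eq: "(cmod z)\<^sup>2 * (cmod w)\<^sup>2 = (Re (cnj z * w))\<^sup>2 + (Im (cnj z * w))\<^sup>2"
  by (metis cmod_power2 complex_mod_cnj norm_mult power_mult_distrib)

text \<open>A positively oriented real basis of the plane; \<open>Im (cnj l * m)\<close> is the area
  of its parallelogram.\<close>

locale plane_basis =
  fixes l m :: complex
  assumes area_pos: "0 < Im (cnj l * m)"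
begin

text \<open>Cramer's rule: \<open>X\<close> and \<open>Y\<close> are the real coordinates with
  respect to the basis \<open>l\<close>, \<open>m\<close>.\<close>

definition X :: "complex \<Rightarrow> real" where "X u = Im (cnj u * m) / Im (cnj l * m)"
definition Y :: "complex \<Rightarrow> real" where "Y u = Im (cnj l * u) / Im (cnj l * m)"

lemma basis_expansion: "of_real (X u) * l + of_real (Y u) * m = u"
proof -
  have "Im (cnj u * m) * l + Im (cnj l * u) * m = Im (cnj l * m) * u"
    by (simp add: complex_eq_iff algebra_simps)
  then show ?thesis
    using area_pos unfolding X_def Y_def of_real_divide
    by (metis (no_types, lifting) add_divide_distrib nonzero_mult_div_cancel_left of_real_eq_0_iff
        order_less_irrefl times_divide_eq_left)
qed

lemma X_add: "X (u + v) = X u + X v" and Y_add: "Y (u + v) = Y u + Y v"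
  and X_diff: "X (u - v) = X u - X v" and Y_diff: "Y (u - v) = Y u - Y v"
  and X_mult: "X (of_real r * u) = r * X u" and Y_mult: "Y (of_real r * u) = r * Y u"
  by (simp_all add: X_def Y_def algebra_simps add_divide_distrib diff_divide_distrib)

lemma X_basis [simp]: "X 0 = 0" "X l = 1" "X m = 0"
  and Y_basis [simp]: "Y 0 = 0" "Y l = 0" "Y m = 1"
  using area_pos by (simp_all add: X_def Y_def)

lemmas XY_simps = X_add Y_add X_diff Y_diff X_mult Y_mult

end

text \<open>Lagrange-Gauss reduction: \<open>l\<close> is a shortest nonzero vector and \<open>m\<close> a shortest one outside \<open>\<real>l\<close>.\<close>

lemma reduced_basis:
  fixes L :: "complex set"
  assumes "0 \<in> L" and diff: "\<And>x y. x \<in> L \<Longrightarrow> y \<in> L \<Longrightarrow> x - y \<in> L"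
    and fin: "\<And>R. finite (L \<inter> cball 0 R)"
    and rank: "a \<in> L" "b \<in> L" "Im (cnj a * b) \<noteq> 0"
  obtains l m where "l \<in> L" "m \<in> L" "0 < Im (cnj l * m)" "(cmod l)\<^sup>2 \<le> 2 * Im (cnj l * m)"
    "\<And>u. u \<in> L \<Longrightarrow> \<exists>i j :: int. u = of_int i * l + of_int j * m"
proof -
  have neg: "- x \<in> L" if "x \<in> L" for x
    using diff[OF \<open>0 \<in> L\<close> that] by simp
  have add: "x + y \<in> L" if "x \<in> L" "y \<in> L" for x y
    using diff[OF that(1) neg[OF that(2)]] by simp
  have nat_mult: "of_nat i * x \<in> L" if "x \<in> L" for i x
    by (induction i) (auto simp: algebra_simps \<open>0 \<in> L\<close> add that)
  have int_mult: "of_int i * x \<in> L" if "x \<in> L" for i x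
    by (cases i rule: int_cases2) (use nat_mult neg that in auto)
  have fin': "finite ((L \<inter> P) \<inter> cball 0 R)" for P R
    by (rule finite_subset[OF _ fin[of R]]) auto
  have "L - {0} \<noteq> {}" using rank by auto
  then obtain l where l: "l \<in> L" "l \<noteq> 0" and l_min: "\<And>y. y \<in> L \<Longrightarrow> y \<noteq> 0 \<Longrightarrow> cmod l \<le> cmod y"
  proof -
    from ex_norm_minimal[OF fin'[of "- {0}"]] \<open>L - {0} \<noteq> {}\<close> obtain x
      where "x \<in> L \<inter> - {0}" "\<And>y. y \<in> L \<inter> - {0} \<Longrightarrow> cmod x \<le> cmod y"
      by (metis Diff_eq)
    then show thesis using that by blast
  qed
  define M where "M = L \<inter> {y. Im (cnj l * y) \<noteq> 0}"
  \<comment> \<open>Otherwise \<open>cnj l * a\<close> and \<open>cnj l * b\<close> are both real,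
    and so is \<open>cnj a * b\<close> up to the factor \<open>(cmod l)^2\<close>, against the
    choice of \<open>a\<close> and \<open>b\<close>.\<close>
  have "M \<noteq> {}"
  proof
    assume "M = {}"
    then have z: "Im (cnj l * a) = 0" "Im (cnj l * b) = 0" using rank by (auto simp: M_def)
    have "(cmod l)\<^sup>2 * Im (cnj a * b) = Im (cnj (cnj l * a) * (cnj l * b))"
      unfolding cmod_power2 by (simp add: algebra_simps power2_eq_square)
    also have "\<dots> = 0" unfolding times_complex.sel(2)[of "cnj (cnj l * a)"] by (simp only: z cnj.sel)
    finally show False using l rank by simp
  qed
  then obtain n where n: "n \<in> M" and n_min: "\<And>y. y \<in> M \<Longrightarrow> cmod n \<le> cmod y"
    using ex_norm_minimal[OF fin'[of "{y. Im (cnj l * y) \<noteq> 0}"]] unfolding M_def by metis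
  \<comment> \<open>The sign is chosen to make the basis positively oriented; lengths are
    unaffected.\<close>
  define m where "m = (if Im (cnj l * n) > 0 then n else - n)"
  have m: "m \<in> L" "0 < Im (cnj l * m)" "cmod m = cmod n"
    using n neg by (auto simp: m_def M_def split: if_splits)
  interpret plane_basis l m by unfold_locales (rule m)
  have ln: "cmod l \<le> cmod m"
    using l_min[of m] m by (metis mult_zero_right order_less_irrefl zero_complex.sel(2))
  have X0: "u = of_real (X u) * l" if "Y u = 0" for u
    using basis_expansion[of u] that by simp
  have M_iff: "y \<in> M \<longleftrightarrow> y \<in> L \<and> Y y \<noteq> 0" for y
    using area_pos by (simp add: M_def Y_def)
  \<comment> \<open>A nonzero lattice vector with both coordinates at most 1/2 in modulus would
    undercut a minimal one: \<open>l\<close> if it lies on the line of \<open>l\<close>, and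
    \<open>m\<close> otherwise.\<close>
  have small: "u = 0" if u: "u \<in> L" "\<bar>X u\<bar> \<le> 1/2" "\<bar>Y u\<bar> \<le> 1/2" for u
  proof (cases "Y u = 0")
    case True
    show ?thesis
    proof (rule ccontr)
      assume "u \<noteq> 0"
      have "cmod u = \<bar>X u\<bar> * cmod l" by (subst X0[OF True]) (simp add: norm_mult)
      also have "\<dots> \<le> 1/2 * cmod l" by (intro mult_right_mono u) auto
      also have "\<dots> < cmod l" using l by simp
      finally show False using l_min[OF u(1) \<open>u \<noteq> 0\<close>] by simp
    qed
  next
    case False
    \<comment> \<open>Strict Cauchy-Schwarz, since \<open>l\<close> and \<open>m\<close> are not
      parallel. It makes the total of the three terms below strictly less than (1/4 + 1/4 + 1/2)
      times \<open>(cmod m)^2\<close>.\<close>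
    have Re_lt: "\<bar>Re (cnj l * m)\<bar> < cmod l * cmod m"
    proof -
      have "(Re (cnj l * m))\<^sup>2 < (cmod l * cmod m)\<^sup>2"
        using cmod_prod_sq_eq[of l m] m(2) by (simp add: power_mult_distrib)
      then show ?thesis by (metis abs_le_square_iff abs_mult abs_norm_cancel not_le)
    qed
    have "(cmod u)\<^sup>2 = (X u)\<^sup>2 * (cmod l)\<^sup>2 + (Y u)\<^sup>2 * (cmod m)\<^sup>2 + 2 * (X u * Y u * Re (cnj l * m))"
      by (subst basis_expansion[of u, symmetric], simp only: cmod_power2)
         (simp add: algebra_simps power2_eq_square)
    also have "\<dots> < (cmod m)\<^sup>2"
    proof -
      have "(X u)\<^sup>2 \<le> (1/2)\<^sup>2" "(Y u)\<^sup>2 \<le> (1/2)\<^sup>2"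
        using u(2,3) abs_le_square_iff[of "X u" "1/2"] abs_le_square_iff[of "Y u" "1/2"] by auto
      then have "(X u)\<^sup>2 * (cmod l)\<^sup>2 \<le> (1/2)\<^sup>2 * (cmod m)\<^sup>2" "(Y u)\<^sup>2 * (cmod m)\<^sup>2 \<le> (1/2)\<^sup>2 * (cmod m)\<^sup>2"
        using ln power_mono[OF ln norm_ge_zero, of 2]
        by (auto intro!: mult_mono simp: power_mono)
      moreover have "X u * Y u * Re (cnj l * m) \<le> 1/4 * \<bar>Re (cnj l * m)\<bar>"
      proof -
        have "\<bar>X u\<bar> * \<bar>Y u\<bar> \<le> 1/2 * (1/2)" by (intro mult_mono u) auto
        then have "\<bar>X u * Y u\<bar> * \<bar>Re (cnj l * m)\<bar> \<le> 1/4 * \<bar>Re (cnj l * m)\<bar>"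
          by (intro mult_right_mono) (auto simp: abs_mult)
        then show ?thesis by (metis abs_ge_self abs_mult order_trans)
      qed
      moreover have "\<bar>Re (cnj l * m)\<bar> < (cmod m)\<^sup>2"
        using Re_lt mult_right_mono[OF ln, of "cmod m"] by (simp add: power2_eq_square)
      ultimately show ?thesis by (simp add: power2_eq_square)
    qed
    finally have "cmod u < cmod m" by (simp add: power_less_imp_less_base)
    moreover have "u \<in> M" using u False by (simp add: M_iff)
    ultimately show ?thesis using n_min[of u] m(3) by simp
  qed
  have "\<exists>i j :: int. u = of_int i * l + of_int j * m" if u: "u \<in> L" for u
  proof -
    \<comment> \<open>Rounding both coordinates leaves a lattice vector to which
      \<open>small\<close> applies.\<close>
    define i j where "i = round (X u)" and "j = round (Y u)"
    have "u - (of_int i * l + of_int j * m) \<in> L"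
      by (intro diff add int_mult u l m)
    moreover have "X (u - (of_int i * l + of_int j * m)) = X u - of_int i"
      "Y (u - (of_int i * l + of_int j * m)) = Y u - of_int j"
      using X_mult[of "of_int i" l] X_mult[of "of_int j" m] Y_mult[of "of_int i" l] Y_mult[of "of_int j" m]
      by (simp_all add: XY_simps)
    ultimately have "u - (of_int i * l + of_int j * m) = 0"
      using of_int_round_abs_le[of "X u"] of_int_round_abs_le[of "Y u"]
      by (intro small) (auto simp: i_def j_def abs_minus_commute)
    then show ?thesis by (intro exI[of _ i] exI[of _ j]) simp
  qed
  moreover have "(cmod l)\<^sup>2 \<le> 2 * Im (cnj l * m)"
  proof -
    \<comment> \<open>Minimality of \<open>m\<close> against \<open>m + l\<close> and
      \<open>m - l\<close> bounds the inner product by half of \<open>(cmod l)^2\<close>. With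
      Lagrange's identity and \<open>cmod l \<le> cmod m\<close> this yields 3
      \<open>(cmod l)^4\<close> \<le> 4 \<open>(Im (cnj l * m))^2\<close>, which implies the factor
      2.\<close>
    have ge: "cmod m \<le> cmod (m + l)" "cmod m \<le> cmod (m - l)"
      using n_min[of "m + l"] n_min[of "m - l"] add diff l m by (auto simp: M_iff XY_simps)
    then have "(cmod m)\<^sup>2 \<le> (cmod (m + l))\<^sup>2" "(cmod m)\<^sup>2 \<le> (cmod (m - l))\<^sup>2"
      by (auto intro: power_mono)
    then have "2 * Re (cnj l * m) \<le> (cmod l)\<^sup>2" "- (2 * Re (cnj l * m)) \<le> (cmod l)\<^sup>2"
      unfolding cmod_power2 by (simp_all add: algebra_simps power2_eq_square)
    then have "2 * \<bar>Re (cnj l * m)\<bar> \<le> (cmod l)\<^sup>2"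
      by linarith
    then have "(2 * \<bar>Re (cnj l * m)\<bar>)\<^sup>2 \<le> ((cmod l)\<^sup>2)\<^sup>2"
      by (intro power_mono) auto
    moreover have four_sq: "(2 * r)\<^sup>2 = 4 * r\<^sup>2" for r :: real
      by (simp add: power_mult_distrib)
    ultimately have Re_le: "4 * (Re (cnj l * m))\<^sup>2 \<le> ((cmod l)\<^sup>2)\<^sup>2"
      by simp
    have "(cmod l)\<^sup>2 \<le> (cmod m)\<^sup>2"
      using ln by (simp add: power_mono)
    then have "((cmod l)\<^sup>2)\<^sup>2 \<le> (cmod l)\<^sup>2 * (cmod m)\<^sup>2"
      unfolding power2_eq_square[of "(cmod l)\<^sup>2"] by (intro mult_left_mono) auto
    then have "((cmod l)\<^sup>2)\<^sup>2 \<le> (2 * Im (cnj l * m))\<^sup>2"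
      using cmod_prod_sq_eq[of l m] Re_le four_sq[of "Im (cnj l * m)"]
        zero_le_power2[of "(cmod l)\<^sup>2"] by linarith
    then show ?thesis by (rule power2_le_imp_le) (use m(2) in linarith)
  qed
  ultimately show thesis using that[OF l(1) m(1,2)] by blast
qed

subsection \<open>Zeros of theta functions in a fundamental cell\<close>

text \<open>Near \<open>z\<close> the function \<open>f\<close> is a power of \<open>u - z\<close>
  times a nonvanishing factor, and \<open>h\<close> is absorbed into that factor. The point
  \<open>w\<close> rules out that \<open>f\<close> vanishes identically.\<close>

lemma zorder_unit_mult:
  assumes "h holomorphic_on UNIV" "h z \<noteq> 0" "f holomorphic_on UNIV" "f w \<noteq> 0"
  shows "zorder (\<lambda>u. h u * f u) z = zorder f z"
proof -
  from zorder_exist_zero[OF assms(3) open_UNIV connected_UNIV UNIV_I] assms(4)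
  obtain r where r: "r > 0" "zor_poly f z holomorphic_on cball z r" and n: "zorder f z \<ge> 0" and
    "\<forall>w\<in>cball z r. f w = zor_poly f z w * (w - z) ^ nat (zorder f z) \<and> zor_poly f z w \<noteq> 0"
    by (metis UNIV_I less_le order_refl)
  then have eq: "f w = zor_poly f z w * (w - z) ^ nat (zorder f z)" "zor_poly f z w \<noteq> 0"
    if "w \<in> cball z r" for w using that by auto
  show ?thesis
  proof (rule zorder_eqI[where S = "ball z r" and g = "\<lambda>u. h u * zor_poly f z u"])
    show "(\<lambda>u. h u * zor_poly f z u) holomorphic_on ball z r"
      by (intro holomorphic_intros holomorphic_on_subset[OF assms(1)] holomorphic_on_subset[OF r(2)]) auto
    show "h w * f w = h w * zor_poly f z w * (w - z) powi zorder f z" if "w \<in> ball z r" for w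
      using that n by (subst eq(1)) (auto simp: power_int_def)
  qed (use r eq(2)[of z] assms in auto)
qed

text \<open>Translation by \<open>s\<close> adds the derivative of \<open>2 * pi * \<i> * q\<close>
  to the logarithmic derivative, so the two integrals differ by the increment of that
  primitive.\<close>

lemma log_deriv_shift_integral:
  fixes f q :: "complex \<Rightarrow> complex"
  assumes f: "f holomorphic_on UNIV" and q: "q holomorphic_on UNIV"
    and shift: "\<And>u. f (u + s) = exp (2 * of_real pi * \<i> * q u) * f u"
    and nz: "\<And>u. u \<in> closed_segment a b \<Longrightarrow> f u \<noteq> 0"
  shows "contour_integral (linepath (a + s) (b + s)) (\<lambda>u. deriv f u / f u) =
         contour_integral (linepath a b) (\<lambda>u. deriv f u / f u) + 2 * of_real pi * \<i> * (q b - q a)"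
proof -
  let ?g = "\<lambda>u. deriv f u / f u"
  have df: "(f has_field_derivative deriv f u) (at u)" for u
    using f by (auto intro: holomorphic_derivI)
  have dq: "(q has_field_derivative deriv q u) (at u)" for u
    using q by (auto intro: holomorphic_derivI)
  \<comment> \<open>Obtained by differentiating both sides of the functional equation and dividing
    by \<open>f (u + s)\<close>.\<close>
  have g_shift: "?g (u + s) = ?g u + 2 * of_real pi * \<i> * deriv q u" if "f u \<noteq> 0" for u
  proof -
    have "((\<lambda>u. f (u + s)) has_field_derivative deriv f (u + s)) (at u)"
      using df[of "u + s"] by (simp add: DERIV_shift)
    moreover have "((\<lambda>u. f (u + s)) has_field_derivative
        exp (2 * of_real pi * \<i> * q u) * (deriv f u + 2 * of_real pi * \<i> * deriv q u * f u)) (at u)"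
      unfolding shift by (auto intro!: derivative_eq_intros df dq simp: algebra_simps)
    ultimately have "deriv f (u + s) =
        exp (2 * of_real pi * \<i> * q u) * (deriv f u + 2 * of_real pi * \<i> * deriv q u * f u)"
      by (rule DERIV_unique)
    then show ?thesis using that unfolding shift by (simp add: add_divide_distrib)
  qed
  have line: "linepath (a + s) (b + s) x = linepath a b x + s" for x
    by (simp add: linepath_def algebra_simps)
  have "contour_integral (linepath (a + s) (b + s)) ?g =
      integral {0..1} (\<lambda>x. ?g (linepath a b x + s) * (b - a))"
    by (simp add: contour_integral_integral line)
  also have "\<dots> = contour_integral (linepath a b) (\<lambda>u. ?g (u + s))"
    by (simp add: contour_integral_integral)
  also have "\<dots> = contour_integral (linepath a b) (\<lambda>u. ?g u + 2 * of_real pi * \<i> * deriv q u)"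
    by (intro contour_integral_cong) (auto intro!: g_shift nz)
  also have "\<dots> = contour_integral (linepath a b) ?g +
      contour_integral (linepath a b) (\<lambda>u. 2 * of_real pi * \<i> * deriv q u)"
    using nz
    by (intro contour_integral_add contour_integrable_continuous_linepath continuous_intros
        holomorphic_on_imp_continuous_on holomorphic_on_subset[OF f] holomorphic_deriv[OF f, THEN holomorphic_on_subset]
        holomorphic_deriv[OF q, THEN holomorphic_on_subset]) auto
  also have "contour_integral (linepath a b) (\<lambda>u. 2 * of_real pi * \<i> * deriv q u) =
      2 * of_real pi * \<i> * (q b - q a)"
  proof -
    have "((\<lambda>u. 2 * of_real pi * \<i> * deriv q u) has_contour_integral
        (2 * of_real pi * \<i> * q (pathfinish (linepath a b)) - 2 * of_real pi * \<i> * q (pathstart (linepath a b))))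
        (linepath a b)"
      by (rule contour_integral_primitive[where S = UNIV]) (auto intro!: derivative_eq_intros dq)
    then show ?thesis by (simp add: contour_integral_unique algebra_simps)
  qed
  finally show ?thesis .
qed

section \<open>The fundamental cell, winding numbers of its boundary, and the argument
  principle\<close>

context plane_basis
begin

definition cell :: "complex \<Rightarrow> complex set" where
  "cell c = {u. X (u - c) \<in> {0<..<1} \<and> Y (u - c) \<in> {0<..<1}}"

text \<open>Counterclockwise, because the basis is positively oriented.\<close>

definition boundary :: "complex \<Rightarrow> real \<Rightarrow> complex" where
  "boundary c = linepath c (c + l) +++ linepath (c + l) (c + l + m) +++
     linepath (c + l + m) (c + m) +++ linepath (c + m) c"

text \<open>All lattice translates of the cell boundary are avoided, not just the boundary itself.
  Hence a zero off the grid can be moved by integer combinations of \<open>l\<close> and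
  \<open>m\<close> into the open cell.\<close>

definition off_grid :: "complex \<Rightarrow> complex \<Rightarrow> bool" where
  "off_grid c u \<longleftrightarrow> X (u - c) \<notin> \<int> \<and> Y (u - c) \<notin> \<int>"

lemma boundary_path [simp]: "valid_path (boundary c)" "pathfinish (boundary c) = pathstart (boundary c)"
  by (auto simp: boundary_def intro!: valid_path_join)

lemma path_image_boundary: "path_image (boundary c) = closed_segment c (c + l) \<union>
    closed_segment (c + l) (c + l + m) \<union> closed_segment (c + l + m) (c + m) \<union> closed_segment (c + m) c"
  by (simp add: boundary_def path_image_join Un_assoc)

lemma segment_XY:
  assumes "u \<in> closed_segment a b"
  obtains t where "0 \<le> t" "t \<le> 1" "X (u - c) = (1 - t) * X (a - c) + t * X (b - c)"
    "Y (u - c) = (1 - t) * Y (a - c) + t * Y (b - c)"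
proof -
  from assms obtain t where t: "0 \<le> t" "t \<le> 1" "u = (1 - t) *\<^sub>R a + t *\<^sub>R b"
    unfolding in_segment by blast
  have "u - c = of_real (1 - t) * (a - c) + of_real t * (b - c)"
    by (simp add: t scaleR_conv_of_real algebra_simps)
  then show thesis using t that by (simp only: XY_simps) 
qed

text \<open>On each edge one of the two coordinates is constantly 0 or 1.\<close>

lemma boundary_not_off_grid: "u \<in> path_image (boundary c) \<Longrightarrow> \<not> off_grid c u"
  unfolding path_image_boundary off_grid_def
  by (elim UnE; erule segment_XY[where c = c]) (auto simp: XY_simps)

lemma boundary_subset: "path_image (boundary c) \<subseteq> {u. X (u - c) \<in> {0..1} \<and> Y (u - c) \<in> {0..1}}"
  unfolding path_image_boundary
  by (intro subsetI, elim UnE; erule segment_XY[where c = c]) (auto simp: XY_simps)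

lemma off_grid_not_boundary: "off_grid c u \<Longrightarrow> u \<notin> path_image (boundary c)"
  using boundary_not_off_grid by blast

lemma off_grid_cell: "u \<in> cell c \<Longrightarrow> off_grid c u"
  by (auto simp: cell_def off_grid_def Ints_def)

text \<open>The point lies strictly to the left of all four edges, so each edge contributes a real
  part strictly between 0 and 1/2. The total is an integer strictly between 0 and 2.\<close>

lemma winding_number_cell:
  assumes u: "u \<in> cell c"
  shows "winding_number (boundary c) u = 1"
proof -
  let ?D = "Im (cnj l * m)"
  define x y where "x = X (u - c)" and "y = Y (u - c)"
  have xy: "0 < x" "x < 1" "0 < y" "y < 1" using u by (auto simp: cell_def x_def y_def)
  have u_eq: "u = c + (of_real x * l + of_real y * m)"
    using basis_expansion[of "u - c"] by (simp add: x_def y_def)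
  have pos: "0 < Im ((c + l - c) * cnj (c + l - u))" "0 < Im ((c + l + m - (c + l)) * cnj (c + l + m - u))"
    "0 < Im ((c + m - (c + l + m)) * cnj (c + m - u))" "0 < Im ((c - (c + m)) * cnj (c - u))"
  proof -
    have "Im ((c + l - c) * cnj (c + l - u)) = y * ?D" "Im ((c + l + m - (c + l)) * cnj (c + l + m - u)) = (1 - x) * ?D"
      "Im ((c + m - (c + l + m)) * cnj (c + m - u)) = (1 - y) * ?D" "Im ((c - (c + m)) * cnj (c - u)) = x * ?D"
      by (simp_all add: u_eq algebra_simps)
    then show "0 < Im ((c + l - c) * cnj (c + l - u))" "0 < Im ((c + l + m - (c + l)) * cnj (c + l + m - u))"
      "0 < Im ((c + m - (c + l + m)) * cnj (c + m - u))" "0 < Im ((c - (c + m)) * cnj (c - u))"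
      using xy area_pos by simp_all
  qed
  have not_in: "u \<notin> path_image (boundary c)"
    using off_grid_not_boundary[OF off_grid_cell[OF u]] .
  then have seg: "u \<notin> closed_segment c (c + l)" "u \<notin> closed_segment (c + l) (c + l + m)"
    "u \<notin> closed_segment (c + l + m) (c + m)" "u \<notin> closed_segment (c + m) c"
    by (auto simp: path_image_boundary)
  have sum: "winding_number (boundary c) u = winding_number (linepath c (c + l)) u +
      (winding_number (linepath (c + l) (c + l + m)) u + (winding_number (linepath (c + l + m) (c + m)) u +
       winding_number (linepath (c + m) c) u))"
    using seg by (simp add: boundary_def winding_number_join path_image_join)
  show ?thesis
  proof (rule winding_number_eq_1)
    show "0 < Re (winding_number (boundary c) u)"
      using pos seg by (simp only: sum plus_complex.sel) (intro add_pos_pos winding_number_linepath_pos_lt; simp)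
    show "Re (winding_number (boundary c) u) < 2"
      using seg[THEN winding_number_lt_half_linepath] by (simp add: sum)
  qed (use not_in in auto)
qed

text \<open>Off the grid, a point outside the open cell is outside the closed one, which is convex
  and contains the boundary.\<close>

lemma winding_number_off_cell:
  assumes "off_grid c u" "u \<notin> cell c"
  shows "winding_number (boundary c) u = 0"
proof (rule winding_number_zero_outside[OF _ _ _ _ boundary_subset])
  show "convex {u. X (u - c) \<in> {0..1} \<and> Y (u - c) \<in> {0..1}}"
  proof (rule convexI)
    fix a b and r t :: real
    assume *: "a \<in> {u. X (u - c) \<in> {0..1} \<and> Y (u - c) \<in> {0..1}}"
      "b \<in> {u. X (u - c) \<in> {0..1} \<and> Y (u - c) \<in> {0..1}}" and rt: "0 \<le> r" "0 \<le> t" "r + t = 1"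
    have "r *\<^sub>R a + t *\<^sub>R b - c = of_real r * (a - c) + of_real t * (b - c)"
      using rt(3) by (simp add: scaleR_conv_of_real algebra_simps flip: distrib_left of_real_add)
    then have "X (r *\<^sub>R a + t *\<^sub>R b - c) = r * X (a - c) + t * X (b - c)"
      "Y (r *\<^sub>R a + t *\<^sub>R b - c) = r * Y (a - c) + t * Y (b - c)"
      by (simp_all only: X_add X_mult Y_add Y_mult)
    moreover have "r * p + t * q \<in> {0..1}" if "p \<in> {0..1}" "q \<in> {0..1}" for p q :: real
      using convexD[OF convex_real_interval(5) that rt] by simp
    ultimately show "r *\<^sub>R a + t *\<^sub>R b \<in> {u. X (u - c) \<in> {0..1} \<and> Y (u - c) \<in> {0..1}}"
      using * by (simp only: mem_Collect_eq)
  qed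
  show "u \<notin> {u. X (u - c) \<in> {0..1} \<and> Y (u - c) \<in> {0..1}}"
    using assms by (auto simp: off_grid_def cell_def less_le)
qed (auto intro: valid_path_imp_path)

text \<open>Each point of \<open>Z\<close> forbids only countably many values of either coordinate
  of \<open>c\<close>, and the reals are uncountable.\<close>

lemma ex_off_grid:
  assumes "countable Z"
  shows "\<exists>c. \<forall>z\<in>Z. off_grid c z"
proof -
  have "\<exists>s. \<forall>z\<in>Z. P z - s \<notin> \<int>" for P :: "complex \<Rightarrow> real"
  proof -
    have "countable (\<Union>z\<in>Z. \<Union>k::int. {P z - of_int k})"
      using assms by (intro countable_UN) auto
    then obtain s where s: "s \<notin> (\<Union>z\<in>Z. \<Union>k::int. {P z - of_int k})"
      using uncountable_UNIV_real by (metis UNIV_eq_I)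
    have "P z - s \<notin> \<int>" if "z \<in> Z" for z
    proof
      assume "P z - s \<in> \<int>"
      then obtain k where "P z - s = of_int k" by (elim Ints_cases)
      then have "s = P z - of_int k" by simp
      with s that show False by blast
    qed
    then show ?thesis by blast
  qed
  then obtain s t where "\<forall>z\<in>Z. X z - s \<notin> \<int>" "\<forall>z\<in>Z. Y z - t \<notin> \<int>" by metis
  then have "\<forall>z\<in>Z. off_grid (of_real s * l + of_real t * m) z"
    by (simp add: off_grid_def XY_simps)
  then show ?thesis by blast
qed

text \<open>The argument principle turns the number of zeros in the cell into a boundary integral.
  Opposite edges cancel up to the increments of \<open>p\<close> and \<open>q\<close>, which combine
  to \<open>- E\<close> at the corner \<open>c\<close>.\<close>

lemma zero_count:
  fixes f p q :: "complex \<Rightarrow> complex"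
  assumes f: "f holomorphic_on UNIV" and nz: "f z \<noteq> 0"
    and p: "p holomorphic_on UNIV" and q: "q holomorphic_on UNIV"
    and fl: "\<And>u. f (u + l) = exp (2 * of_real pi * \<i> * p u) * f u"
    and fm: "\<And>u. f (u + m) = exp (2 * of_real pi * \<i> * q u) * f u"
    and E: "\<And>u. E = q (u + l) + p u - p (u + m) - q u"
    and off: "\<And>u. f u = 0 \<Longrightarrow> off_grid c u"
  shows "finite {u \<in> cell c. f u = 0}"
    and "of_int (\<Sum>u\<in>{u \<in> cell c. f u = 0}. zorder f u) = - E"
proof -
  \<comment> \<open>Large enough for \<open>ball 0 R\<close> to contain the closed cell, so that the
    argument principle can be applied on this ball.\<close>
  define R where "R = cmod c + cmod l + cmod m + 1"
  have bounded: "{u. X (u - c) \<in> {0..1} \<and> Y (u - c) \<in> {0..1}} \<subseteq> ball 0 R"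
  proof safe
    fix u assume u: "X (u - c) \<in> {0..1}" "Y (u - c) \<in> {0..1}"
    have "cmod u = cmod (c + (of_real (X (u - c)) * l + of_real (Y (u - c)) * m))"
      by (simp add: basis_expansion)
    also have "\<dots> \<le> cmod c + (\<bar>X (u - c)\<bar> * cmod l + \<bar>Y (u - c)\<bar> * cmod m)"
      by (intro norm_triangle_le add_mono order.refl norm_triangle_le) (simp_all add: norm_mult)
    also have "\<dots> \<le> cmod c + (1 * cmod l + 1 * cmod m)"
      using u by (intro add_mono mult_right_mono) auto
    finally show "u \<in> ball 0 R" by (simp add: R_def)
  qed
  have fin: "finite {u \<in> ball 0 R. f u = 0}"
  proof (cases "f constant_on UNIV")
    case True
    then have "{u \<in> ball 0 R. f u = 0} = {}" using nz by (auto simp: constant_on_def)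
    then show ?thesis by (simp only: finite.emptyI)
  next
    case False
    have "finite {u \<in> cball 0 R. f u = 0}"
      by (rule holomorphic_compact_finite_zeros[OF f _ _ _ _ False]) auto
    then show ?thesis by (rule rev_finite_subset) auto
  qed
  have cell_ball: "cell c \<subseteq> ball 0 R"
    by (rule subset_trans[OF _ bounded]) (auto simp: cell_def)
  then show fin_cell: "finite {u \<in> cell c. f u = 0}"
    by (intro finite_subset[OF _ fin]) auto
  let ?g = "\<lambda>u. deriv f u / f u"
  have bd_nz: "f u \<noteq> 0" if "u \<in> path_image (boundary c)" for u
    using off boundary_not_off_grid that by blast
  have "contour_integral (boundary c) (\<lambda>x. deriv f x * 1 / f x) = 2 * pi * \<i> *
      (\<Sum>u\<in>{u \<in> ball (0 :: complex) R. f u = 0 \<or> u \<in> {}}. winding_number (boundary c) u * 1 * zorder f u)"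
  proof (rule argument_principle)
    show "f holomorphic_on ball 0 R - {}" using f by (rule holomorphic_on_subset) auto
    show "path_image (boundary c) \<subseteq> ball 0 R - {w \<in> ball 0 R. f w = 0 \<or> w \<in> {}}"
      using subset_trans[OF boundary_subset bounded] bd_nz by blast
    show "\<forall>u. u \<notin> ball 0 R \<longrightarrow> winding_number (boundary c) u = 0"
    proof safe
      fix u :: complex assume "u \<notin> ball 0 R"
      with subset_trans[OF boundary_subset bounded] show "winding_number (boundary c) u = 0"
        by (intro winding_number_zero_outside[of _ "ball 0 R"]) (auto intro: valid_path_imp_path)
    qed
  qed (use fin in auto)
  \<comment> \<open>The ball may contain further zeros outside the cell; the boundary has winding
    number 0 around them.\<close>
  also have "(\<Sum>u\<in>{u \<in> ball (0 :: complex) R. f u = 0 \<or> u \<in> {}}. winding_number (boundary c) u * 1 * zorder f u) =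
      (\<Sum>u\<in>{u \<in> cell c. f u = 0}. of_int (zorder f u))"
    using fin cell_ball off
    by (intro sum.mono_neutral_cong_right) (auto simp: winding_number_cell, use off winding_number_off_cell in blast)
  finally have count: "contour_integral (boundary c) ?g =
      (2 * of_real pi * \<i>) * of_int (\<Sum>u\<in>{u \<in> cell c. f u = 0}. zorder f u)" by simp
  have segs: "closed_segment c (c + l) \<subseteq> path_image (boundary c)"
    "closed_segment (c + l) (c + l + m) \<subseteq> path_image (boundary c)"
    "closed_segment (c + l + m) (c + m) \<subseteq> path_image (boundary c)"
    "closed_segment (c + m) c \<subseteq> path_image (boundary c)"
    by (auto simp only: path_image_boundary)
  have cont: "continuous_on (closed_segment a b) ?g" if "closed_segment a b \<subseteq> path_image (boundary c)" for a b
    using that bd_nz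
    by (intro continuous_intros holomorphic_on_imp_continuous_on holomorphic_on_subset[OF f]
        holomorphic_deriv[OF f, THEN holomorphic_on_subset]) auto
  note int = segs[THEN cont, THEN contour_integrable_continuous_linepath]
  have "contour_integral (boundary c) ?g = contour_integral (linepath c (c + l)) ?g +
      (contour_integral (linepath (c + l) (c + l + m)) ?g +
      (contour_integral (linepath (c + l + m) (c + m)) ?g + contour_integral (linepath (c + m) c) ?g))"
    unfolding boundary_def by (simp add: int valid_path_join)
  \<comment> \<open>The right edge is the left one shifted by \<open>l\<close>, the top the bottom
    shifted by \<open>m\<close>. The boundary runs through the left and top edges backwards, so only
    the terms from the factors of automorphy survive.\<close>
  moreover have "contour_integral (linepath (c + l) (c + m + l)) ?g =
      contour_integral (linepath c (c + m)) ?g + 2 * of_real pi * \<i> * (p (c + m) - p c)"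
    using segs(4) by (intro log_deriv_shift_integral[OF f p fl] bd_nz) (auto simp: closed_segment_commute)
  moreover have "contour_integral (linepath (c + m) (c + l + m)) ?g =
      contour_integral (linepath c (c + l)) ?g + 2 * of_real pi * \<i> * (q (c + l) - q c)"
    using segs(1) by (intro log_deriv_shift_integral[OF f q fm] bd_nz) auto
  moreover have "contour_integral (linepath (c + l + m) (c + m)) ?g = - contour_integral (linepath (c + m) (c + l + m)) ?g"
    "contour_integral (linepath (c + m) c) ?g = - contour_integral (linepath c (c + m)) ?g"
    by (intro contour_integral_reverse_linepath cont segs)+
  moreover have "c + m + l = c + l + m" by simp
  ultimately have "contour_integral (boundary c) ?g =
      2 * of_real pi * \<i> * (p (c + m) - p c) - 2 * of_real pi * \<i> * (q (c + l) - q c)"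
    by (simp only:) simp
  also have "\<dots> = 2 * of_real pi * \<i> * (- E)"
    unfolding E[of c] by (simp add: algebra_simps)
  finally show "of_int (\<Sum>u\<in>{u \<in> cell c. f u = 0}. zorder f u) = - E"
    unfolding count by (subst (asm) mult_left_cancel) auto
qed

end

subsection \<open>Hermitian forms\<close>

lemma norm_vector_smult: "norm (c *s w) = cmod c * norm (w :: complex ^ 'n)"
  by (simp add: norm_vec_def norm_mult L2_set_right_distrib)

lemma scaleR_eq_smult: "r *\<^sub>R v = complex_of_real r *s v" for v :: "complex ^ 'n"
  by (simp add: vec_eq_iff complex_eq_iff)

lemma hermitian_formD:
  assumes "hermitian_form H"
  shows "H (u + v) w = H u w + H v w" "H (c *s u) v = c * H u v" "H v u = cnj (H u v)"
  using assms unfolding hermitian_form_def by blast+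

lemma hermitian_smult:
  assumes "hermitian_form H"
  shows "H (c *s u) (d *s v) = c * cnj d * H u v"
proof -
  have "H u (d *s v) = cnj (d * H v u)"
    by (simp only: hermitian_formD(3)[OF assms, of u "d *s v"] hermitian_formD(2)[OF assms])
  also have "\<dots> = cnj d * H u v"
    by (simp add: hermitian_formD(3)[OF assms, of u v])
  finally show ?thesis
    by (simp add: hermitian_formD(2)[OF assms])
qed

lemma hermitian_diagonal_real:
  assumes "hermitian_form H"
  shows "Im (H v v) = 0"
proof -
  from arg_cong[OF hermitian_formD(3)[OF assms, of v v], of Im] show ?thesis by simp
qed

text \<open>On a complex line the form is \<open>l * cnj m\<close> times the real number
  \<open>H w w\<close>. The sign cancels the one in \<open>zero_count\<close>, making degrees
  positive.\<close>

lemma Im_hermitian_line: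
  assumes "hermitian_form H"
  shows "Im (H (l *s w) (m *s w)) = - (Im (cnj l * m) * Re (H w w))"
  by (simp add: hermitian_smult[OF assms] hermitian_diagonal_real[OF assms] algebra_simps)

text \<open>The constant is the minimum of \<open>Re (H v v)\<close> on the compact unit sphere;
  homogeneity of degree 2 carries the bound to all vectors.\<close>

lemma polarization_norm_bound:
  assumes "polarization \<Lambda> H"
  obtains c where "c > 0" "\<And>v. c * (norm v)\<^sup>2 \<le> Re (H v v)"
proof -
  from assms have H: "hermitian_form H" and pos: "\<And>v. v \<noteq> 0 \<Longrightarrow> Re (H v v) > 0"
    by (auto simp: polarization_def)
  have add_l: "H (u + v) w = H u w + H v w" for u v w
    by (rule hermitian_formD(1)[OF H])
  have add_r: "H w (u + v) = H w u + H w v" for u v w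
    unfolding hermitian_formD(3)[OF H, of w] add_l by simp
  \<comment> \<open>A sesquilinear form is bilinear over the reals, hence continuous in finite
    dimension.\<close>
  have "bilinear H"
    unfolding bilinear_def
    using hermitian_smult[OF H, of _ _ 1] hermitian_smult[OF H, of 1]
    by (auto intro!: linearI simp: add_l add_r scaleR_eq_smult) (simp_all add: scaleR_conv_of_real)
  then have "bounded_bilinear H" by (simp add: bilinear_conv_bounded_bilinear)
  then have cont: "continuous_on (sphere 0 1) (\<lambda>v. Re (H v v))"
    by (intro continuous_intros bounded_bilinear.continuous_on[of H])
  have "sphere (0 :: complex ^ 'a) 1 \<noteq> {}" by simp
  with continuous_attains_inf[OF compact_sphere _ cont]
  obtain e where e: "norm e = 1" "\<And>v. norm v = 1 \<Longrightarrow> Re (H e e) \<le> Re (H v v)" by auto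
  show thesis
  proof (rule that)
    show "Re (H e e) > 0" using e by (intro pos) auto
    fix v
    show "Re (H e e) * (norm v)\<^sup>2 \<le> Re (H v v)"
    proof (cases "v = 0")
      case True
      then show ?thesis using hermitian_smult[OF H, of 0 v 0 v] by simp
    next
      case False
      define u where "u = v /\<^sub>R norm v"
      have v: "v = complex_of_real (norm v) *s u"
        using False by (simp add: u_def flip: scaleR_eq_smult)
      have "Re (H e e) \<le> Re (H u u)" using False by (intro e) (simp add: u_def)
      moreover have "Re (H v v) = (norm v)\<^sup>2 * Re (H u u)"
        by (subst (1 2) v) (simp add: hermitian_smult[OF H] power2_eq_square)
      ultimately show ?thesis by (simp add: mult.commute mult_right_mono)
    qed
  qed
qed

subsection \<open>Intersection with elliptic curves\<close>

lemma vec_line_eq_span: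
  assumes "vec.subspace W" "vec.dim W = 1"
  obtains w where "w \<noteq> 0" "W = vec.span {w}"
proof -
  obtain B where B: "B \<subseteq> W" "vec.independent B" "W \<subseteq> vec.span B" "card B = vec.dim W"
    using vec.basis_exists by metis
  then obtain w where w: "B = {w}" using assms(2) by (metis card_1_singletonE)
  have "W = vec.span {w}"
    using B(1,3) w vec.span_minimal[OF B(1) assms(1)] by auto
  moreover have "w \<noteq> 0" using B(2) w vec.dependent_zero by blast
  ultimately show thesis using that by blast
qed

lemma in_vec_span_singleton: "v \<in> vec.span {w} \<longleftrightarrow> (\<exists>k. v = k *s w)"
  by (auto simp: vec.span_singleton)

lemma torus_proj_eq_iff:
  assumes "lattice_in \<Lambda> W"
  shows "torus_proj \<Lambda> x = torus_proj \<Lambda> y \<longleftrightarrow> x - y \<in> \<Lambda>"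
proof
  have zero: "0 \<in> \<Lambda>" and diff: "\<And>a b. a \<in> \<Lambda> \<Longrightarrow> b \<in> \<Lambda> \<Longrightarrow> a - b \<in> \<Lambda>"
    using assms by (auto simp: lattice_in_def)
  {
    assume "torus_proj \<Lambda> x = torus_proj \<Lambda> y"
    then have "x + 0 \<in> torus_proj \<Lambda> y" using zero unfolding torus_proj_def by blast
    then show "x - y \<in> \<Lambda>" by (auto simp: torus_proj_def)
  }
  have sub: "torus_proj \<Lambda> a \<subseteq> torus_proj \<Lambda> b" if "b - a \<in> \<Lambda>" for a b
  proof
    fix z assume "z \<in> torus_proj \<Lambda> a"
    then obtain n where "n \<in> \<Lambda>" "z = a + n" by (auto simp: torus_proj_def)
    moreover from this have "n - (b - a) \<in> \<Lambda>" using diff that by blast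
    ultimately show "z \<in> torus_proj \<Lambda> b"
      unfolding torus_proj_def by (intro image_eqI[of _ _ "n - (b - a)"]) auto
  qed
  assume "x - y \<in> \<Lambda>"
  moreover from diff[OF zero this] have "y - x \<in> \<Lambda>" by simp
  ultimately show "torus_proj \<Lambda> x = torus_proj \<Lambda> y" using sub by blast
qed

text \<open>
  Otherwise sending \<open>r\<close> to a lattice vector in \<open>r w' + \<complex>w\<close> would embed \<open>\<real>\<close> into the countable set \<open>\<Lambda>\<close>.
\<close>

lemma tangent_line_unique:
  assumes \<Lambda>: "lattice_in \<Lambda> V" and "countable \<Lambda>"
    and sub: "torus_proj \<Lambda> ` vec.span {w'} \<subseteq> torus_proj \<Lambda> ` vec.span {w}"
  shows "w' \<in> vec.span {w}"
proof (rule ccontr)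
  assume notin: "w' \<notin> vec.span {w}"
  have "\<exists>k. complex_of_real r *s w' - k *s w \<in> \<Lambda>" for r
  proof -
    have "complex_of_real r *s w' \<in> vec.span {w'}" by (auto simp: in_vec_span_singleton)
    with sub obtain v where "v \<in> vec.span {w}"
      "torus_proj \<Lambda> (complex_of_real r *s w') = torus_proj \<Lambda> v" by blast
    then show ?thesis by (auto simp: in_vec_span_singleton torus_proj_eq_iff[OF \<Lambda>])
  qed
  then obtain k where k: "\<And>r. complex_of_real r *s w' - k r *s w \<in> \<Lambda>" by metis
  have "inj (\<lambda>r. complex_of_real r *s w' - k r *s w)"
  proof (rule injI)
    fix r s assume "complex_of_real r *s w' - k r *s w = complex_of_real s *s w' - k s *s w"
    then have eq: "complex_of_real (r - s) *s w' = (k r - k s) *s w"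
      by (simp add: vec_eq_iff algebra_simps)
    show "r = s"
    proof (rule ccontr)
      assume "r \<noteq> s"
      then have "w' = ((k r - k s) / complex_of_real (r - s)) *s w"
        using eq by (simp add: vec_eq_iff field_simps)
      with notin show False by (auto simp: in_vec_span_singleton)
    qed
  qed
  moreover have "range (\<lambda>r. complex_of_real r *s w' - k r *s w) \<subseteq> \<Lambda>" using k by blast
  ultimately have "countable (UNIV :: real set)"
    using \<open>countable \<Lambda>\<close> by (metis countable_image_inj_on countable_subset)
  then show False using uncountable_UNIV_real by blast
qed

section \<open>Intersection points as zeros of the theta function along a line\<close>

lemma translate_torus_line:
  "translate a (torus_proj \<Lambda> ` vec.span {w}) = range (\<lambda>u. torus_proj \<Lambda> (a + u *s w))"
proof -
  have "(\<lambda>z. a + z) ` torus_proj \<Lambda> v = torus_proj \<Lambda> (a + v)" for v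
    by (simp add: torus_proj_def image_image add.assoc)
  then show ?thesis
    unfolding translate_def by (simp add: image_image vec.span_singleton)
qed

text \<open>The zero set of \<theta> is periodic, so the choice of a representative does not
  matter.\<close>

lemma torus_proj_in_support_iff:
  assumes \<Lambda>: "lattice_in \<Lambda> V" and period: "\<And>z n. n \<in> \<Lambda> \<Longrightarrow> \<theta> (z + n) = 0 \<longleftrightarrow> \<theta> z = 0"
  shows "torus_proj \<Lambda> z \<in> divisor_support \<Lambda> \<theta> \<longleftrightarrow> \<theta> z = 0"
proof
  assume "torus_proj \<Lambda> z \<in> divisor_support \<Lambda> \<theta>"
  then obtain y where "\<theta> y = 0" "z - y \<in> \<Lambda>"
    by (auto simp: divisor_support_def torus_proj_eq_iff[OF \<Lambda>])
  then show "\<theta> z = 0" using period[of "z - y" y] by simp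
qed (auto simp: divisor_support_def)

text \<open>Chain rule: \<open>D\<close> commutes with complex scalars, so along the line the
  derivative is multiplication by \<open>D w\<close>.\<close>

lemma entire_restrict_line:
  assumes "entire \<theta>"
  shows "(\<lambda>u. \<theta> (a + u *s w)) holomorphic_on UNIV"
proof (rule holomorphic_onI)
  fix u
  obtain D where D: "(\<theta> has_derivative D) (at (a + u *s w))" "\<And>c v. D (c *s v) = c * D v"
    using assms unfolding entire_def by blast
  have "linear (\<lambda>h :: complex. h *s w)"
    by (rule linearI) (simp_all add: vec_eq_iff algebra_simps)
  then have "((\<lambda>u. a + u *s w) has_derivative (\<lambda>h. h *s w)) (at u)"
    by (auto intro!: derivative_eq_intros bounded_linear_imp_has_derivative simp: linear_conv_bounded_linear)
  from has_derivative_compose[OF this D(1)]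
  have "((\<lambda>u. \<theta> (a + u *s w)) has_field_derivative D w) (at u)"
    by (simp add: has_field_derivative_def D(2) mult_commute_abs)
  then show "(\<lambda>u. \<theta> (a + u *s w)) field_differentiable (at u within UNIV)"
    by (auto simp: field_differentiable_def)
qed

text \<open>The representative picked by \<open>SOME\<close> differs from \<open>a + u *s w\<close>
  by a lattice vector. The resulting exponential factor has no zeros and leaves the order
  unchanged.\<close>

lemma local_intersection_eq_zorder:
  assumes \<Lambda>: "lattice_in \<Lambda> V" and \<theta>: "entire \<theta>" and g: "\<And>n. n \<in> \<Lambda> \<Longrightarrow> entire (g n)"
    and shift: "\<And>n z. n \<in> \<Lambda> \<Longrightarrow> \<theta> (z + n) = exp (2 * of_real pi * \<i> * g n z) * \<theta> z"
    and nz: "\<theta> (a + v *s w) \<noteq> 0"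
  shows "local_intersection \<theta> w (torus_proj \<Lambda> (a + u *s w)) = zorder (\<lambda>u. \<theta> (a + u *s w)) u"
proof -
  define z where "z = (SOME z. z \<in> torus_proj \<Lambda> (a + u *s w))"
  have "a + u *s w + 0 \<in> torus_proj \<Lambda> (a + u *s w)"
    using \<Lambda> unfolding lattice_in_def torus_proj_def by blast
  then have "z \<in> torus_proj \<Lambda> (a + u *s w)" unfolding z_def by (rule someI)
  then obtain n where n: "n \<in> \<Lambda>" "z = a + u *s w + n" by (auto simp: torus_proj_def)
  let ?f = "\<lambda>x. \<theta> (a + (x + u) *s w)"
  have "\<theta> (z + x *s w) = exp (2 * of_real pi * \<i> * g n (a + u *s w + x *s w)) * ?f x" for x
  proof -
    have "z + x *s w = (a + u *s w + x *s w) + n" by (simp add: n ac_simps)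
    moreover have "a + u *s w + x *s w = a + (x + u) *s w" by (simp add: vec.scale_left_distrib)
    ultimately show ?thesis by (simp only: shift[OF n(1)])
  qed
  then have "local_intersection \<theta> w (torus_proj \<Lambda> (a + u *s w)) =
      zorder (\<lambda>x. exp (2 * of_real pi * \<i> * g n (a + u *s w + x *s w)) * ?f x) 0"
    by (simp add: local_intersection_def flip: z_def)
  also have "\<dots> = zorder ?f 0"
  proof (rule zorder_unit_mult)
    show "(\<lambda>x. exp (2 * of_real pi * \<i> * g n (a + u *s w + x *s w))) holomorphic_on UNIV"
      by (intro holomorphic_intros entire_restrict_line g n)
    show "?f holomorphic_on UNIV"
      using entire_restrict_line[OF \<theta>, of "a + u *s w" w] by (simp add: vec.scale_left_distrib ac_simps)
    show "?f (v - u) \<noteq> 0" using nz by simp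
  qed simp
  also have "\<dots> = zorder (\<lambda>u. \<theta> (a + u *s w)) u"
    by (simp add: zorder_shift[of _ u])
  finally show ?thesis .
qed

text \<open>
  Moving the fundamental cell off the zeros makes the intersection points correspond to the zeros of
  the restricted theta function inside the cell, which \<open>plane_basis.zero_count\<close> counts.
\<close>

lemma intersection_sum:
  assumes \<Lambda>: "lattice_in \<Lambda> V" and H: "hermitian_form H" and div: "associated_divisor \<Lambda> H \<theta>"
    and area: "0 < Im (cnj l * m)" and lm: "l *s w \<in> \<Lambda>" "m *s w \<in> \<Lambda>"
    and gen: "\<And>u. u *s w \<in> \<Lambda> \<Longrightarrow> \<exists>i j :: int. u = of_int i * l + of_int j * m"
    and F: "F = torus_proj \<Lambda> ` vec.span {w}"
    and not_sub: "\<not> translate a F \<subseteq> divisor_support \<Lambda> \<theta>"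
  shows "real_of_int (\<Sum>p\<in>translate a F \<inter> divisor_support \<Lambda> \<theta>. local_intersection \<theta> w p) =
    Im (cnj l * m) * Re (H w w)"
proof -
  interpret plane_basis l m by unfold_locales (rule area)
  from div obtain g where \<theta>: "entire \<theta>" and g: "\<And>n. n \<in> \<Lambda> \<Longrightarrow> entire (g n)"
    and shift: "\<And>n z. n \<in> \<Lambda> \<Longrightarrow> \<theta> (z + n) = exp (2 * of_real pi * \<i> * g n z) * \<theta> z"
    and chern: "\<And>n k z. n \<in> \<Lambda> \<Longrightarrow> k \<in> \<Lambda> \<Longrightarrow>
      of_real (Im (H n k)) = g k (z + n) + g n z - g n (z + k) - g k z"
    unfolding associated_divisor_def by metis
  have period: "\<theta> (z + n) = 0 \<longleftrightarrow> \<theta> z = 0" if "n \<in> \<Lambda>" for z n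
    using shift[OF that] by simp
  note curve = translate_torus_line[of a \<Lambda> w, folded F]
    and supp = torus_proj_in_support_iff[OF \<Lambda> period]
  define f where "f u = \<theta> (a + u *s w)" for u
  define P where "P u = torus_proj \<Lambda> (a + u *s w)" for u
  have f: "f holomorphic_on UNIV" unfolding f_def by (rule entire_restrict_line[OF \<theta>])
  \<comment> \<open>So the restriction \<open>f\<close> is not identically zero and has only
    countably many zeros, which a suitable corner \<open>c\<close> puts off the grid.\<close>
  have "\<exists>v. f v \<noteq> 0" using not_sub by (auto simp: curve supp f_def)
  then obtain v where v: "f v \<noteq> 0" ..
  have line: "a + (x + y) *s w = (a + x *s w) + y *s w" for x y
    by (simp add: vec.scale_left_distrib add.assoc)
  have "countable {u. f u = 0}"
  proof (cases "f constant_on UNIV")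
    case True
    then have "{u. f u = 0} = {}" using v by (auto simp: constant_on_def)
    then show ?thesis by simp
  next
    case False
    then show ?thesis
      using holomorphic_countable_zeros[OF f open_UNIV connected_UNIV fsigma_UNIV False] by simp
  qed
  then obtain c where c: "\<And>u. f u = 0 \<Longrightarrow> off_grid c u"
    using ex_off_grid by blast
  let ?Z = "{u \<in> cell c. f u = 0}"
  have count: "finite ?Z" "of_int (\<Sum>u\<in>?Z. zorder f u) = - complex_of_real (Im (H (l *s w) (m *s w)))"
  proof (atomize (full), intro conjI)
    let ?p = "\<lambda>u. g (l *s w) (a + u *s w)" and ?q = "\<lambda>u. g (m *s w) (a + u *s w)"
    have hol: "?p holomorphic_on UNIV" "?q holomorphic_on UNIV"
      by (intro entire_restrict_line g lm)+
    have fl: "f (u + l) = exp (2 * of_real pi * \<i> * ?p u) * f u"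
      and fm: "f (u + m) = exp (2 * of_real pi * \<i> * ?q u) * f u" for u
      unfolding f_def line by (intro shift lm)+
    have E: "complex_of_real (Im (H (l *s w) (m *s w))) = ?q (u + l) + ?p u - ?p (u + m) - ?q u" for u
      unfolding line by (intro chern lm)
    show "finite ?Z"
      by (rule zero_count(1)[OF f v hol fl fm E c])
    show "of_int (\<Sum>u\<in>?Z. zorder f u) = - complex_of_real (Im (H (l *s w) (m *s w)))"
      by (rule zero_count(2)[OF f v hol fl fm E c])
  qed
  have f_period: "f (u + k) = 0 \<longleftrightarrow> f u = 0" if "k *s w \<in> \<Lambda>" for u k
    unfolding f_def line using period[OF that] .
  have P_eq: "P x = P y \<longleftrightarrow> (x - y) *s w \<in> \<Lambda>" for x y
    unfolding P_def torus_proj_eq_iff[OF \<Lambda>] by (simp add: vec.scale_left_diff_distrib)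
  have zero: "0 \<in> \<Lambda>" and diff: "\<And>x y. x \<in> \<Lambda> \<Longrightarrow> y \<in> \<Lambda> \<Longrightarrow> x - y \<in> \<Lambda>"
    using \<Lambda> by (auto simp: lattice_in_def)
  have neg: "- x \<in> \<Lambda>" if "x \<in> \<Lambda>" for x using diff[OF zero that] by simp
  have add: "x + y \<in> \<Lambda>" if "x \<in> \<Lambda>" "y \<in> \<Lambda>" for x y using diff[OF that(1) neg[OF that(2)]] by simp
  have nat_mult: "of_nat i *s x \<in> \<Lambda>" if "x \<in> \<Lambda>" for i x
    by (induction i) (auto simp: vec.scale_left_distrib zero add that)
  have int_mult: "of_int i *s x \<in> \<Lambda>" if "x \<in> \<Lambda>" for i x
    by (cases i rule: int_cases2) (use nat_mult neg that in \<open>auto simp: vec.scale_minus_left\<close>)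
  \<comment> \<open>Two points of the open cell with the same image differ by integer coordinates of
    modulus less than 1.\<close>
  have inj: "inj_on P ?Z"
  proof (rule inj_onI)
    fix x y assume xy: "x \<in> ?Z" "y \<in> ?Z" "P x = P y"
    then obtain i j :: int where ij: "x - y = of_int i * l + of_int j * m"
      using gen P_eq by blast
    have "X (x - y) = of_int i" "Y (x - y) = of_int j"
      unfolding ij using X_mult[of "of_int i" l] X_mult[of "of_int j" m] Y_mult[of "of_int i" l] Y_mult[of "of_int j" m]
      by (simp_all add: XY_simps)
    moreover have "\<bar>X (x - y)\<bar> < 1" "\<bar>Y (x - y)\<bar> < 1"
      using xy by (auto simp: cell_def XY_simps)
    ultimately have "i = 0" "j = 0" by linarith+
    with ij show "x = y" by simp
  qed
  have img: "translate a F \<inter> divisor_support \<Lambda> \<theta> = P ` ?Z"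
  proof (intro equalityI subsetI)
    fix p assume "p \<in> translate a F \<inter> divisor_support \<Lambda> \<theta>"
    then obtain u where u: "p = P u" "f u = 0" by (auto simp: curve supp f_def P_def)
    \<comment> \<open>Subtracting the integer parts of the coordinates moves the zero into the cell;
      being off the grid, its fractional parts are not 0.\<close>
    define k where "k = of_int \<lfloor>X (u - c)\<rfloor> * l + of_int \<lfloor>Y (u - c)\<rfloor> * m"
    have k: "k *s w \<in> \<Lambda>"
      unfolding k_def vec.scale_left_distrib vec.scale_scale[symmetric]
      by (intro add int_mult lm)
    have "f ((u - k) + k) = 0" using u by simp
    then have fk: "f (u - k) = 0" unfolding f_period[OF k] .
    have "X (u - k - c) = X (u - c) - of_int \<lfloor>X (u - c)\<rfloor>" "Y (u - k - c) = Y (u - c) - of_int \<lfloor>Y (u - c)\<rfloor>"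
      unfolding k_def using X_mult[of "of_int \<lfloor>X (u - c)\<rfloor>" l] X_mult[of "of_int \<lfloor>Y (u - c)\<rfloor>" m]
        Y_mult[of "of_int \<lfloor>X (u - c)\<rfloor>" l] Y_mult[of "of_int \<lfloor>Y (u - c)\<rfloor>" m]
      by (simp_all add: X_add Y_add X_diff Y_diff)
    moreover have "X (u - c) \<notin> \<int>" "Y (u - c) \<notin> \<int>" using c[OF u(2)] by (auto simp: off_grid_def)
    then have "frac (X (u - c)) \<in> {0<..<1}" "frac (Y (u - c)) \<in> {0<..<1}"
      by (auto simp: frac_lt_1 frac_gt_0_iff)
    ultimately have "u - k \<in> cell c" by (simp add: cell_def frac_def)
    moreover have "P u = P (u - k)" unfolding P_eq using k by simp
    ultimately show "p \<in> P ` ?Z" using u fk by blast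
  next
    fix p assume "p \<in> P ` ?Z"
    then show "p \<in> translate a F \<inter> divisor_support \<Lambda> \<theta>"
      by (auto simp: curve supp f_def P_def)
  qed
  have "(\<Sum>p\<in>translate a F \<inter> divisor_support \<Lambda> \<theta>. local_intersection \<theta> w p) = (\<Sum>u\<in>?Z. zorder f u)"
    unfolding img sum.reindex[OF inj]
  proof (rule sum.cong[OF refl])
    fix u
    show "(local_intersection \<theta> w \<circ> P) u = zorder f u"
      using local_intersection_eq_zorder[OF \<Lambda> \<theta> g shift v[unfolded f_def], of u] by (simp add: f_def[abs_def] P_def)
  qed
  moreover have "of_int (\<Sum>u\<in>?Z. zorder f u) = complex_of_real (Im (cnj l * m) * Re (H w w))"
    using count(2) unfolding Im_hermitian_line[OF H] by (simp only: of_real_minus minus_minus)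
  ultimately show ?thesis
    by (metis of_real_eq_iff of_real_of_int_eq)
qed

section \<open>The period lattice of an elliptic curve, its degree and a short generator\<close>

text \<open>The periods \<open>L\<close> of the line inherit local finiteness from \<Lambda>, and
  they have rank two because the lattice points on the line span it over the reals. So
  \<open>reduced_basis\<close> applies.\<close>

lemma elliptic_curve_lattice:
  assumes \<Lambda>: "lattice_in \<Lambda> V" and fin: "\<And>R. finite (\<Lambda> \<inter> cball 0 R)"
    and w: "w \<noteq> 0" and W: "lattice_in (\<Lambda> \<inter> vec.span {w}) (vec.span {w})"
  obtains l m where "l *s w \<in> \<Lambda>" "m *s w \<in> \<Lambda>" "0 < Im (cnj l * m)" "(cmod l)\<^sup>2 \<le> 2 * Im (cnj l * m)"
    "\<And>u. u *s w \<in> \<Lambda> \<Longrightarrow> \<exists>i j :: int. u = of_int i * l + of_int j * m"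
proof -
  define L where "L = {u. u *s w \<in> \<Lambda>}"
  have zero: "0 \<in> L" and diff: "\<And>x y. x \<in> L \<Longrightarrow> y \<in> L \<Longrightarrow> x - y \<in> L"
    using \<Lambda> by (auto simp: L_def lattice_in_def vec.scale_left_diff_distrib)
  have finL: "finite (L \<inter> cball 0 R)" for R
  proof (rule finite_imageD)
    have "(\<lambda>u. u *s w) ` (L \<inter> cball 0 R) \<subseteq> \<Lambda> \<inter> cball 0 (R * norm w)"
      by (auto simp: L_def norm_vector_smult mult_right_mono)
    then show "finite ((\<lambda>u. u *s w) ` (L \<inter> cball 0 R))" using fin by (rule finite_subset)
    show "inj_on (\<lambda>u. u *s w) (L \<inter> cball 0 R)"
      using w by (auto intro!: inj_onI simp: vec.scale_right_imp_eq)
  qed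
  have span: "span (\<Lambda> \<inter> vec.span {w}) = vec.span {w}" using W by (simp add: lattice_in_def)
  \<comment> \<open>If all periods were real multiples of one of them, \<open>a\<close>, the real
    span of the lattice points on the line would be the real line through \<open>a *s w\<close>,
    which misses \<open>(\<i> * a) *s w\<close>.\<close>
  have "\<exists>a\<in>L. \<exists>b\<in>L. Im (cnj a * b) \<noteq> 0"
  proof (rule ccontr)
    assume "\<not> ?thesis"
    then have col: "Im (cnj a * b) = 0" if "a \<in> L" "b \<in> L" for a b using that by blast
    have "\<exists>a\<in>L. a \<noteq> 0"
    proof (rule ccontr)
      assume "\<not> ?thesis"
      then have "\<Lambda> \<inter> vec.span {w} \<subseteq> {0}" by (auto simp: L_def in_vec_span_singleton)
      then have "vec.span {w} \<subseteq> {0}" using span by (metis span_mono span_insert_0 span_empty)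
      moreover have "w \<in> vec.span {w}" by (simp add: vec.span_base)
      ultimately show False using w by blast
    qed
    then obtain a where a: "a \<in> L" "a \<noteq> 0" by blast
    have "\<Lambda> \<inter> vec.span {w} \<subseteq> span {a *s w}"
    proof
      fix v assume "v \<in> \<Lambda> \<inter> vec.span {w}"
      then obtain b where b: "v = b *s w" "b \<in> L" by (auto simp: L_def in_vec_span_singleton)
      have "cnj a * b = of_real (Re (cnj a * b))" using col[OF a(1) b(2)] by (simp add: complex_eq_iff)
      then have "b * of_real ((cmod a)\<^sup>2) = of_real (Re (cnj a * b)) * a"
        by (metis complex_norm_square mult.assoc mult.commute)
      then have "b = of_real (Re (cnj a * b) / (cmod a)\<^sup>2) * a" using a(2) by (simp add: field_simps)
      then have "v = (Re (cnj a * b) / (cmod a)\<^sup>2) *\<^sub>R (a *s w)"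
        unfolding scaleR_eq_smult vec.scale_scale b(1) by simp
      then show "v \<in> span {a *s w}" by (simp only: span_base span_scale insertI1)
    qed
    then have "vec.span {w} \<subseteq> span {a *s w}" using span by (metis span_minimal subspace_span)
    moreover have "(\<i> * a) *s w \<in> vec.span {w}" by (auto simp: in_vec_span_singleton)
    ultimately obtain r where "(\<i> * a) *s w = r *\<^sub>R (a *s w)" by (auto simp: span_singleton)
    then have "(\<i> * a) *s w = (of_real r * a) *s w" by (simp add: scaleR_eq_smult)
    then have "\<i> * a = of_real r * a" using w by (simp add: vec.scale_right_imp_eq)
    then have "\<i> = complex_of_real r" using a(2) by simp
    then show False by (simp add: complex_eq_iff)
  qed
  then obtain a b where "a \<in> L" "b \<in> L" "Im (cnj a * b) \<noteq> 0" by blast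
  from reduced_basis[OF zero diff finL this] obtain l m where
    "l \<in> L" "m \<in> L" "0 < Im (cnj l * m)" "(cmod l)\<^sup>2 \<le> 2 * Im (cnj l * m)"
    "\<And>u. u \<in> L \<Longrightarrow> \<exists>i j :: int. u = of_int i * l + of_int j * m"
    by blast
  then show thesis using that unfolding L_def mem_Collect_eq by blast
qed

text \<open>The description by \<open>THE\<close> is met by exactly one number:
  \<open>intersection_sum\<close> gives the same value for all admissible translates and tangent
  vectors, and an admissible translate exists.\<close>

lemma intersection_number_elliptic_curve:
  assumes \<Lambda>: "lattice_in \<Lambda> V" and cnt: "countable \<Lambda>"
    and H: "hermitian_form H" and div: "associated_divisor \<Lambda> H \<theta>"
    and w: "w \<noteq> 0" and area: "0 < Im (cnj l * m)" and lm: "l *s w \<in> \<Lambda>" "m *s w \<in> \<Lambda>"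
    and gen: "\<And>u. u *s w \<in> \<Lambda> \<Longrightarrow> \<exists>i j :: int. u = of_int i * l + of_int j * m"
  shows "real_of_int (intersection_number \<Lambda> (torus_proj \<Lambda> ` vec.span {w}) \<theta>) = Im (cnj l * m) * Re (H w w)"
proof -
  define F where "F = torus_proj \<Lambda> ` vec.span {w}"
  let ?n = "\<lambda>a w. \<Sum>p \<in> translate a F \<inter> divisor_support \<Lambda> \<theta>. local_intersection \<theta> w p"
  have sum: "real_of_int (?n a v) = Im (cnj l * m) * Re (H w w)"
    if v: "v \<noteq> 0" "torus_proj \<Lambda> ` vec.span {v} = F" and a: "\<not> translate a F \<subseteq> divisor_support \<Lambda> \<theta>" for a v
  proof -
    \<comment> \<open>Tangent vectors of one curve are proportional. With \<open>w = k *s v\<close>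
      the cell area for \<open>v\<close> is \<open>(cmod k)^2\<close> times that for
      \<open>w\<close>, while \<open>H v v\<close> is smaller than \<open>H w w\<close> by the same
      factor, so the product is unchanged.\<close>
    have "w \<in> vec.span {v}"
      using tangent_line_unique[OF \<Lambda> cnt, of w v] v(2) by (simp add: F_def)
    then obtain k where k: "w = k *s v" by (auto simp: in_vec_span_singleton)
    then have "k \<noteq> 0" using w by auto
    have area_k: "Im (cnj (l * k) * (m * k)) = (cmod k)\<^sup>2 * Im (cnj l * m)"
    proof -
      have "cnj (l * k) * (m * k) = of_real ((cmod k)\<^sup>2) * (cnj l * m)"
        unfolding complex_norm_square by (simp add: ac_simps)
      then show ?thesis by (simp only: Im_complex_of_real Re_complex_of_real times_complex.sel)
    qed
    have "real_of_int (?n a v) = Im (cnj (l * k) * (m * k)) * Re (H v v)"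
    proof (rule intersection_sum[OF \<Lambda> H div _ _ _ _ v(2)[symmetric] a])
      show "0 < Im (cnj (l * k) * (m * k))" unfolding area_k using area \<open>k \<noteq> 0\<close> by (intro mult_pos_pos) auto
      show "(l * k) *s v \<in> \<Lambda>" "(m * k) *s v \<in> \<Lambda>" using lm by (simp_all add: k)
      fix u assume u: "u *s v \<in> \<Lambda>"
      then have "(u / k) *s w \<in> \<Lambda>" using \<open>k \<noteq> 0\<close> by (simp add: k)
      from gen[OF this] obtain i j :: int where "u / k = of_int i * l + of_int j * m" by blast
      then have "u = of_int i * (l * k) + of_int j * (m * k)" using \<open>k \<noteq> 0\<close> by (simp add: field_simps)
      then show "\<exists>i j :: int. u = of_int i * (l * k) + of_int j * (m * k)" by blast
    qed
    also have "\<dots> = Im (cnj l * m) * Re (H w w)"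
    proof -
      have "H w w = of_real ((cmod k)\<^sup>2) * H v v"
        unfolding k complex_norm_square by (rule hermitian_smult[OF H])
      then have "Re (H w w) = (cmod k)\<^sup>2 * Re (H v v)" by simp
      then show ?thesis unfolding area_k by simp
    qed
    finally show ?thesis .
  qed
  \<comment> \<open>Translating by a point where \<theta> does not vanish moves the curve out of the
    divisor; this excludes a vacuous description.\<close>
  from div obtain z where z: "\<theta> z \<noteq> 0" by (auto simp: associated_divisor_def)
  have period: "\<theta> (x + n) = 0 \<longleftrightarrow> \<theta> x = 0" if "n \<in> \<Lambda>" for x n
    using div that by (auto simp: associated_divisor_def)
  have "torus_proj \<Lambda> (z + 0 *s w) \<in> translate z F"
    unfolding F_def translate_torus_line by blast
  moreover have "torus_proj \<Lambda> (z + 0 *s w) \<notin> divisor_support \<Lambda> \<theta>"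
    using z by (simp add: torus_proj_in_support_iff[OF \<Lambda> period])
  ultimately have not_sub: "\<not> translate z F \<subseteq> divisor_support \<Lambda> \<theta>" by blast
  have "intersection_number \<Lambda> F \<theta> = ?n z w"
    unfolding intersection_number_def
  proof (rule the_equality)
    show "\<forall>a v. v \<noteq> 0 \<longrightarrow> torus_proj \<Lambda> ` vec.span {v} = F \<longrightarrow>
        \<not> translate a F \<subseteq> divisor_support \<Lambda> \<theta> \<longrightarrow> ?n z w = ?n a v"
    proof (intro allI impI)
      fix a v assume "v \<noteq> 0" "torus_proj \<Lambda> ` vec.span {v} = F" "\<not> translate a F \<subseteq> divisor_support \<Lambda> \<theta>"
      from sum[OF this] sum[OF w F_def[symmetric] not_sub] have "real_of_int (?n z w) = real_of_int (?n a v)"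
        by simp
      then show "?n z w = ?n a v" by (simp only: of_int_eq_iff)
    qed
  next
    fix n assume "\<forall>a v. v \<noteq> 0 \<longrightarrow> torus_proj \<Lambda> ` vec.span {v} = F \<longrightarrow>
        \<not> translate a F \<subseteq> divisor_support \<Lambda> \<theta> \<longrightarrow> n = ?n a v"
    then show "n = ?n z w" using w F_def not_sub by blast
  qed
  with sum[OF w F_def[symmetric] not_sub] show ?thesis by (simp add: F_def)
qed

text \<open>The vector is \<open>l *s w\<close> for the first vector \<open>l\<close> of the reduced
  basis: its squared \<open>H\<close>-length is at most twice the cell area in the metric of
  \<open>H\<close>, and that area is the degree.\<close>

lemma elliptic_curve_short_vector:
  assumes \<Lambda>: "lattice_in \<Lambda> V" and fin: "\<And>R. finite (\<Lambda> \<inter> cball 0 R)"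
    and pol: "polarization \<Lambda> H" and div: "associated_divisor \<Lambda> H \<theta>"
    and F: "elliptic_curve_in \<Lambda> F"
  obtains x where "x \<in> \<Lambda>" "F = torus_proj \<Lambda> ` vec.span {x}"
    "Re (H x x) \<le> 2 * real_of_int (intersection_number \<Lambda> F \<theta>)"
proof -
  from F obtain W where W: "vec.subspace W" "vec.dim W = 1" "lattice_in (\<Lambda> \<inter> W) W" "F = torus_proj \<Lambda> ` W"
    by (auto simp: elliptic_curve_in_def complex_subtorus_def)
  obtain w where w: "w \<noteq> 0" "W = vec.span {w}" using vec_line_eq_span[OF W(1,2)] .
  obtain l m where lm: "l *s w \<in> \<Lambda>" "m *s w \<in> \<Lambda>" "0 < Im (cnj l * m)" "(cmod l)\<^sup>2 \<le> 2 * Im (cnj l * m)"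
    "\<And>u. u *s w \<in> \<Lambda> \<Longrightarrow> \<exists>i j :: int. u = of_int i * l + of_int j * m"
    using elliptic_curve_lattice[OF \<Lambda> fin w(1) W(3)[unfolded w(2)]] by blast
  have H: "hermitian_form H" and pos: "Re (H w w) > 0" using pol w(1) by (auto simp: polarization_def)
  have deg: "real_of_int (intersection_number \<Lambda> F \<theta>) = Im (cnj l * m) * Re (H w w)"
    unfolding W(4) w(2)
    by (rule intersection_number_elliptic_curve[OF \<Lambda> countable_if_finite_cballs[OF fin] H div w(1) lm(3,1,2,5)])
  show thesis
  proof (rule that[OF lm(1)])
    have "H (l *s w) (l *s w) = of_real ((cmod l)\<^sup>2) * H w w"
      unfolding complex_norm_square by (rule hermitian_smult[OF H])
    then have "Re (H (l *s w) (l *s w)) = (cmod l)\<^sup>2 * Re (H w w)" by simp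
    also have "\<dots> \<le> 2 * Im (cnj l * m) * Re (H w w)" using lm(4) pos by (intro mult_right_mono) auto
    finally show "Re (H (l *s w) (l *s w)) \<le> 2 * real_of_int (intersection_number \<Lambda> F \<theta>)"
      by (simp only: deg mult.assoc)
    have "l \<noteq> 0" using lm(3) by auto
    have "vec.span {w} = vec.span {l *s w}"
    proof (intro equalityI subsetI)
      fix v assume "v \<in> vec.span {w}"
      then obtain k where "v = k *s w" by (auto simp: in_vec_span_singleton)
      then have "v = (k / l) *s (l *s w)" using \<open>l \<noteq> 0\<close> by simp
      then show "v \<in> vec.span {l *s w}" by (auto simp only: in_vec_span_singleton)
    qed (auto simp: in_vec_span_singleton)
    then show "F = torus_proj \<Lambda> ` vec.span {l *s w}" by (simp add: W(4) w(2))
  qed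
qed

section \<open>Counting the curves through short lattice vectors\<close>

theorem mainTheorem6:
  fixes \<Lambda> :: "(complex ^ 3) set"
    and H :: "complex ^ 3 \<Rightarrow> complex ^ 3 \<Rightarrow> complex"
    and \<theta> :: "complex ^ 3 \<Rightarrow> complex"
  assumes "lattice_in \<Lambda> UNIV"
    and "polarization \<Lambda> H"
    and "associated_divisor \<Lambda> H \<theta>"
  shows "(\<forall>t\<ge>1. finite (elliptic_curves_upto \<Lambda> \<theta> t)) \<and>
         (\<lambda>t. real (card (elliptic_curves_upto \<Lambda> \<theta> t))) \<in> O(\<lambda>t. real t ^ 5)"
proof -
  obtain C where C: "C > 0" "\<And>R. R \<ge> 1 \<Longrightarrow> finite (\<Lambda> \<inter> cball 0 R)"
    "\<And>R. R \<ge> 1 \<Longrightarrow> real (card (\<Lambda> \<inter> cball 0 R)) \<le> C * R ^ 6"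
    using discrete_subgroup_card_bound[of \<Lambda>] assms(1) by (auto simp: lattice_in_def)
  have fin: "finite (\<Lambda> \<inter> cball 0 R)" for R
    by (rule finite_subset[OF _ C(2)[of "max 1 R"]]) auto
  obtain c where c: "c > 0" "\<And>v. c * (norm v)\<^sup>2 \<le> Re (H v v)"
    using polarization_norm_bound[OF assms(2)] by blast
  \<comment> \<open>The root converts \<open>c * (norm x)^2 \<le> 2 * t\<close> into
    \<open>norm x \<le> K * sqrt t\<close>; the maximum with 1 keeps this radius at least 1 for
    \<open>t \<ge> 1\<close>, as the counting bound demands.\<close>
  define K where "K = max 1 (sqrt (2 / c))"
  have K: "K \<ge> 1" "2 / c \<le> K\<^sup>2"
    using power_mono[of "sqrt (2 / c)" K 2] c(1) by (auto simp: K_def)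
  let ?curve = "\<lambda>x. torus_proj \<Lambda> ` vec.span {x}"
  \<comment> \<open>Only an inclusion: a short vector may be 0 or may span a line that gives no
    elliptic curve, which is harmless for an upper bound.\<close>
  have sub: "elliptic_curves_upto \<Lambda> \<theta> t \<subseteq> ?curve ` (\<Lambda> \<inter> cball 0 (K * sqrt t))" for t
  proof
    fix F assume "F \<in> elliptic_curves_upto \<Lambda> \<theta> t"
    then have F: "elliptic_curve_in \<Lambda> F" and deg: "intersection_number \<Lambda> F \<theta> \<le> int t"
      by (auto simp: elliptic_curves_upto_def)
    obtain x where x: "x \<in> \<Lambda>" "F = ?curve x" "Re (H x x) \<le> 2 * real_of_int (intersection_number \<Lambda> F \<theta>)"
      using elliptic_curve_short_vector[OF assms(1) fin assms(2,3) F] .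
    have "c * (norm x)\<^sup>2 \<le> 2 * real t" using c(2)[of x] x(3) deg by linarith
    then have "(norm x)\<^sup>2 \<le> 2 / c * real t" using c(1) by (simp add: field_simps)
    also have "\<dots> \<le> K\<^sup>2 * real t" using K(2) by (intro mult_right_mono) auto
    also have "\<dots> = (K * sqrt (real t))\<^sup>2" by (simp add: power_mult_distrib)
    finally have "norm x \<le> K * sqrt (real t)" by (rule power2_le_imp_le) (use K(1) in simp)
    with x show "F \<in> ?curve ` (\<Lambda> \<inter> cball 0 (K * sqrt t))" by auto
  qed
  have bound: "real (card (elliptic_curves_upto \<Lambda> \<theta> t)) \<le> C * K ^ 6 * real t ^ 5" if t: "t \<ge> 1" for t
  proof -
    have R: "K * sqrt t \<ge> 1" using K(1) t mult_mono[of 1 K 1 "sqrt t"] by simp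
    have "card (elliptic_curves_upto \<Lambda> \<theta> t) \<le> card (?curve ` (\<Lambda> \<inter> cball 0 (K * sqrt t)))"
      using fin by (intro card_mono sub) auto
    also have "\<dots> \<le> card (\<Lambda> \<inter> cball 0 (K * sqrt t))" by (intro card_image_le fin)
    finally have "real (card (elliptic_curves_upto \<Lambda> \<theta> t)) \<le> C * (K * sqrt t) ^ 6"
      using C(3)[OF R] by linarith
    \<comment> \<open>The exponent 6 is the real dimension of the space, so radius
      \<open>K * sqrt t\<close> gives order \<open>t^3\<close>.\<close>
    also have "(K * sqrt t) ^ 6 = K ^ 6 * real t ^ 3"
      using power_mult[of "sqrt t" 2 3] by (simp add: power_mult_distrib)
    also have "C * (K ^ 6 * real t ^ 3) \<le> C * (K ^ 6 * real t ^ 5)"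
      using C(1) K(1) t by (intro mult_left_mono power_increasing) auto
    finally show ?thesis by (simp add: mult.assoc)
  qed
  show ?thesis
  proof
    show "\<forall>t\<ge>1. finite (elliptic_curves_upto \<Lambda> \<theta> t)"
      using finite_subset[OF sub] fin by blast
    show "(\<lambda>t. real (card (elliptic_curves_upto \<Lambda> \<theta> t))) \<in> O(\<lambda>t. real t ^ 5)"
      using bound by (intro bigoI[of _ "C * K ^ 6"] eventually_at_top_linorderI[of 1]) auto
  qed
qed

end
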